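(* Let $X$ be a real Banach space with $\dim X\ge 2$. If $X$ is uniformly non-square, then $\mathrm{DR}_B(X)<2$. More precisely, $$\mathrm{DR}_B(X)\le \mathrm{DR}(X)\le \tfrac12\,\mathrm{DW}(X).$$ Hence $\mathrm{DW}(X)<4$ implies $\mathrm{DR}_B(X)<2$.
   Context: Birkhoff orthogonality: $x\perp_B y$ iff $\|x+\lambda y\|\ge\|x\|$ for all $\lambda\in\mathbb R$. For nonzero $x,y\in X$ put $\alpha[x,y]=\left\|\frac{x}{\|x\|}-\frac{y}{\|y\|}\right\|$ and $\beta[x,y]=\left\|\frac{x}{\|y\|}-\frac{y}{\|x\|}\right\|$. Define $$\mathrm{DR}(X)=\sup\left\{\frac{\alpha[x,y]}{\beta[x,y]}: x,y\ne 0,\ \beta[x,y]\ne 0\right\},$$ $$\mathrm{DR}_B(X)=\sup\left\{\frac{\alpha[x,y]}{\beta[x,y]}: x,y\in X\setminus\{0\},\ x\perp_B y,\ \beta[x,y]\ne 0\right\},$$ and the Dunkl--Williams constant $$\mathrm{DW}(X)=\sup\left\{\frac{\|x\|+\|y\|}{\|x-y\|}\left\|\frac{x}{\|x\|}-\frac{y}{\|y\|}\right\|: x,y\in X,\ x\ne0,\ y\ne0,\ x\ne y\right\}.$$ $X$ is uniformly non-square iff $\varepsilon_0(X)<2$, where $\varepsilon_0(X)=\sup\{\varepsilon\in[0,2]:\delta_X(\varepsilon)=0\}$ and $\delta_X(\varepsilon)=\inf\{1-\|\frac{x+y}{2}\|: \|x\|=\|y\|=1,\ \|x-y\|\ge\varepsilon\}$.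 *)

theory Defs
  imports Complex_Main
begin

definition birkhoff_orth :: "'a::real_normed_vector \<Rightarrow> 'a \<Rightarrow> bool" (infix \<open>\<bottom>\<^sub>B\<close> 50) where
  "x \<bottom>\<^sub>B y \<longleftrightarrow> (\<forall>l::real. norm (x + l *\<^sub>R y) \<ge> norm x)"

definition ang :: "'a::real_normed_vector \<Rightarrow> 'a \<Rightarrow> real" where
  "ang x y = norm (x /\<^sub>R norm x - y /\<^sub>R norm y)"

definition skew_ang :: "'a::real_normed_vector \<Rightarrow> 'a \<Rightarrow> real" where
  "skew_ang x y = norm (x /\<^sub>R norm y - y /\<^sub>R norm x)"

text \<open>
  The constants of a space are functions of its type. The sets under \<open>Sup\<close> and \<open>Inf\<close> below are
  bounded, and nonempty in dimension at least 2 (the modulus being taken at arguments in \<open>[0,2]\<close>),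
  so these are genuine real suprema and infima; see the lemmas at the end for the first three.
\<close>

definition DR :: "'a::real_normed_vector itself \<Rightarrow> real" where
  "DR (X :: 'a itself) =
     Sup {ang x y / skew_ang x y | x y :: 'a. x \<noteq> 0 \<and> y \<noteq> 0 \<and> skew_ang x y \<noteq> 0}"

definition DR_B :: "'a::real_normed_vector itself \<Rightarrow> real" where
  "DR_B (X :: 'a itself) =
     Sup {ang x y / skew_ang x y | x y :: 'a.
            x \<noteq> 0 \<and> y \<noteq> 0 \<and> x \<bottom>\<^sub>B y \<and> skew_ang x y \<noteq> 0}"

definition DW :: "'a::real_normed_vector itself \<Rightarrow> real" where
  "DW (X :: 'a itself) =
     Sup {(norm x + norm y) / norm (x - y) * norm (x /\<^sub>R norm x - y /\<^sub>R norm y) | x y :: 'a.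
            x \<noteq> 0 \<and> y \<noteq> 0 \<and> x \<noteq> y}"

definition modulus_convexity :: "'a::real_normed_vector itself \<Rightarrow> real \<Rightarrow> real" where
  "modulus_convexity (X :: 'a itself) e =
     Inf {1 - norm ((x + y) /\<^sub>R 2) | x y :: 'a. norm x = 1 \<and> norm y = 1 \<and> norm (x - y) \<ge> e}"

definition char_convexity :: "'a::real_normed_vector itself \<Rightarrow> real" where
  "char_convexity (X :: 'a itself) = Sup {e \<in> {0..2}. modulus_convexity X e = 0}"

definition uniformly_nonsquare :: "'a::real_normed_vector itself \<Rightarrow> bool" where
  "uniformly_nonsquare (X :: 'a itself) \<longleftrightarrow> char_convexity X < 2"

lemma norm_times_ang_le:
  fixes x y :: "'a::real_normed_vector"
  assumes "x \<noteq> 0" "y \<noteq> 0"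
  shows "norm x * ang x y \<le> 2 * norm (x - y)"
proof -
  have "norm x * ang x y = norm (norm x *\<^sub>R (x /\<^sub>R norm x - y /\<^sub>R norm y))"
    by (simp add: ang_def)
  also have "norm x *\<^sub>R (x /\<^sub>R norm x - y /\<^sub>R norm y)
      = (x - y) + (norm y - norm x) *\<^sub>R (y /\<^sub>R norm y)"
    using assms by (simp add: scaleR_diff_right scaleR_diff_left left_diff_distrib)
  also have "norm \<dots> \<le> norm (x - y) + \<bar>norm y - norm x\<bar>"
    using norm_triangle_ineq[of "x - y" "(norm y - norm x) *\<^sub>R (y /\<^sub>R norm y)"] assms
    by (simp add: abs_mult mult.assoc)
  also have "\<dots> \<le> 2 * norm (x - y)"
    using norm_triangle_ineq3[of x y] by linarith
  finally show ?thesis .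
qed

lemma ang_bound:
  fixes x y :: "'a::real_normed_vector"
  assumes "x \<noteq> 0" "y \<noteq> 0"
  shows "(norm x + norm y) * ang x y \<le> 4 * norm (x - y)"
  using norm_times_ang_le[OF assms] norm_times_ang_le[OF assms(2,1)]
  by (simp add: ang_def norm_minus_commute distrib_right)

lemma bdd_above_DW:
  "bdd_above {(norm x + norm y) / norm (x - y) * norm (x /\<^sub>R norm x - y /\<^sub>R norm y) |
     x y :: 'a::real_normed_vector. x \<noteq> 0 \<and> y \<noteq> 0 \<and> x \<noteq> y}"
  using ang_bound by (intro bdd_aboveI[of _ 4]) (auto simp: field_simps ang_def)

lemma ang_le_skew_ang:
  fixes x y :: "'a::real_normed_vector"
  assumes "x \<noteq> 0" "y \<noteq> 0"
  shows "ang x y \<le> 2 * skew_ang x y"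
proof -
  define s where "s = norm x / norm y"
  have s: "s > 0" using assms by (simp add: s_def)
  have "ang (x /\<^sub>R norm y) (y /\<^sub>R norm x) = ang x y"
    using assms by (simp add: ang_def field_simps)
  then have "(s + 1 / s) * ang x y \<le> 4 * skew_ang x y"
    using ang_bound[of "x /\<^sub>R norm y" "y /\<^sub>R norm x"] assms
    by (simp add: s_def skew_ang_def field_simps)
  moreover have "s + 1 / s \<ge> 2"
  proof -
    have "(s - 1)\<^sup>2 / s \<ge> 0" using s by simp
    also have "(s - 1)\<^sup>2 / s = s + 1 / s - 2"
      using s by (simp add: power2_eq_square field_simps)
    finally show ?thesis by simp
  qed
  moreover have "ang x y \<ge> 0" by (simp add: ang_def)
  ultimately show ?thesis
    using mult_right_mono[of 2 "s + 1 / s" "ang x y"] by linarith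
qed

lemma bdd_above_DR:
  "bdd_above {ang x y / skew_ang x y |
     x y :: 'a::real_normed_vector. x \<noteq> 0 \<and> y \<noteq> 0 \<and> skew_ang x y \<noteq> 0}"
proof (rule bdd_aboveI[of _ 2], clarify)
  fix x y :: 'a assume "x \<noteq> 0" "y \<noteq> 0" "skew_ang x y \<noteq> 0"
  moreover have "skew_ang x y \<ge> 0" by (simp add: skew_ang_def)
  ultimately show "ang x y / skew_ang x y \<le> 2"
    using ang_le_skew_ang[of x y] by (simp add: divide_le_eq)
qed

lemma bdd_above_DR_B:
  "bdd_above {ang x y / skew_ang x y |
     x y :: 'a::real_normed_vector. x \<noteq> 0 \<and> y \<noteq> 0 \<and> x \<bottom>\<^sub>B y \<and> skew_ang x y \<noteq> 0}"
  by (rule bdd_above_mono[OF bdd_above_DR]) blast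

end

theory Submission
  imports Defs
begin

text \<open>
  For the bound by the Dunkl--Williams constant, evaluate its quotient at \<open>x / \<parallel>y\<parallel>\<close> and \<open>y / \<parallel>x\<parallel>\<close>,
  whose norms \<open>s\<close> and \<open>1 / s\<close> have sum at least 2.

  For the strict inequality, let \<open>u, v\<close> be unit vectors, \<open>s \<ge> 1\<close> and \<open>w = s u - v / s\<close>. If
  \<open>\<parallel>u - v\<parallel>\<close> is almost \<open>2 \<parallel>w\<parallel>\<close>, then \<open>s (u - v) = w - (s - 1 / s) v\<close> forces \<open>s\<close> to be close to 1
  and \<open>s - 1 / s\<close> to be close to \<open>\<parallel>w\<parallel>\<close>. Hence \<open>\<parallel>w - \<parallel>w\<parallel> v\<parallel>\<close> is almost \<open>2 \<parallel>w\<parallel>\<close>, and so is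
  \<open>\<parallel>w + \<parallel>w\<parallel> v\<parallel> = \<parallel>s u - (1 / s - \<parallel>w\<parallel>) v\<parallel> \<ge> s - 1 / s + \<parallel>w\<parallel>\<close>: the unit vectors \<open>w / \<parallel>w\<parallel>\<close> and \<open>v\<close>
  span an almost square section of the unit ball.
\<close>

text \<open>The point of the line through \<open>x\<close> in direction \<open>y\<close> nearest to
  the origin is Birkhoff orthogonal to \<open>y\<close>; it exists by compactness.\<close>

lemma birkhoff_orth_translate_exists:
  fixes x y :: "'a::real_normed_vector"
  assumes "y \<noteq> 0"
  shows "\<exists>l. (x + l *\<^sub>R y) \<bottom>\<^sub>B y"
proof -
  \<comment> \<open>For \<open>\<bar>l\<bar> \<ge> r\<close> the norm of
    \<open>l *\<^sub>R y\<close> is at least \<open>2 * norm x\<close>, so the value at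
    \<open>l\<close> is no smaller than the value at 0.\<close>
  define r where "r = 2 * norm x / norm y"
  have r: "r \<ge> 0" by (simp add: r_def)
  have "continuous_on {-r..r} (\<lambda>l. norm (x + l *\<^sub>R y))"
    by (intro continuous_intros)
  then obtain m where m: "m \<in> {-r..r}"
      and min: "\<And>l. l \<in> {-r..r} \<Longrightarrow> norm (x + m *\<^sub>R y) \<le> norm (x + l *\<^sub>R y)"
    using continuous_attains_inf[of "{-r..r}" "\<lambda>l. norm (x + l *\<^sub>R y)"] r by fastforce
  have "norm (x + m *\<^sub>R y) \<le> norm (x + l *\<^sub>R y)" for l
  proof (cases "l \<in> {-r..r}")
    case False
    then have "r \<le> \<bar>l\<bar>" by auto
    then have "r * norm y \<le> \<bar>l\<bar> * norm y" by (simp add: mult_right_mono)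
    then have "2 * norm x \<le> norm (l *\<^sub>R y)" using assms by (simp add: r_def)
    then have "norm x \<le> norm (x + l *\<^sub>R y)"
      using norm_triangle_ineq2[of "l *\<^sub>R y" "- x"] by (simp add: add.commute)
    then show ?thesis using min[of 0] r by simp
  qed (rule min)
  then have "norm (x + m *\<^sub>R y) \<le> norm (x + m *\<^sub>R y + l *\<^sub>R y)" for l
    by (metis add.assoc scaleR_left_distrib)
  then show ?thesis by (auto simp: birkhoff_orth_def)
qed

text \<open>Supplies an element of the sets whose suprema are \<open>DR_B\<close> and
  \<open>DR\<close>. Translating \<open>x\<close> along \<open>y\<close> keeps it outside
  \<open>span {y}\<close>, whereas a vanishing \<open>skew_ang\<close> would make the vectors
  parallel.\<close>

lemma birkhoff_orth_pair_exists:
  fixes x y :: "'a::real_normed_vector"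
  assumes "x \<noteq> y" "independent {x, y}"
  obtains z where "z \<noteq> 0" "y \<noteq> 0" "z \<bottom>\<^sub>B y" "skew_ang z y \<noteq> 0"
proof -
  have y: "y \<noteq> 0" using assms dependent_zero by blast
  have x: "x \<notin> span {y}"
    using assms by (auto simp: independent_insert split: if_splits)
  obtain l where l: "(x + l *\<^sub>R y) \<bottom>\<^sub>B y"
    using birkhoff_orth_translate_exists[OF y] by blast
  define z where "z = x + l *\<^sub>R y"
  have z: "z \<notin> span {y}"
  proof
    assume "z \<in> span {y}"
    then have "z - l *\<^sub>R y \<in> span {y}"
      by (simp add: span_diff span_scale span_base)
    with x show False by (simp add: z_def)
  qed
  have "z \<noteq> 0" using z span_zero by blast
  moreover have "skew_ang z y \<noteq> 0"
  proof
    assume "skew_ang z y = 0"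
    then have "z /\<^sub>R norm y = y /\<^sub>R norm z" by (simp add: skew_ang_def)
    then have "norm y *\<^sub>R (z /\<^sub>R norm y) = norm y *\<^sub>R (y /\<^sub>R norm z)" by simp
    then have "z = (norm y / norm z) *\<^sub>R y" using y by (simp add: divide_inverse)
    moreover have "(norm y / norm z) *\<^sub>R y \<in> span {y}"
      by (intro span_scale span_base) auto
    ultimately show False using z by simp
  qed
  ultimately show thesis using that l y by (simp add: z_def)
qed

lemma skew_ang_commute: "skew_ang x y = skew_ang y x"
  by (simp add: skew_ang_def norm_minus_commute)

lemma ang_commute: "ang x y = ang y x"
  by (simp add: ang_def norm_minus_commute)

lemma DW_upper:
  fixes x y :: "'a::real_normed_vector"
  assumes "x \<noteq> 0" "y \<noteq> 0" "x \<noteq> y"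
  shows "(norm x + norm y) / norm (x - y) * ang x y \<le> DW TYPE('a)"
  unfolding DW_def ang_def
  by (rule cSup_upper[OF _ bdd_above_DW]) (use assms in blast)

lemma ang_le_half_DW_times_skew_ang:
  fixes x y :: "'a::real_normed_vector"
  assumes "x \<noteq> 0" "y \<noteq> 0" "skew_ang x y \<noteq> 0"
  shows "ang x y / skew_ang x y \<le> 1 / 2 * DW TYPE('a)"
proof -
  define s where "s = norm x / norm y"
  have s: "s > 0" using assms by (simp add: s_def)
  have "ang (x /\<^sub>R norm y) (y /\<^sub>R norm x) = ang x y"
    using assms by (simp add: ang_def field_simps)
  moreover have "x /\<^sub>R norm y \<noteq> y /\<^sub>R norm x"
    using assms by (auto simp: skew_ang_def)
  ultimately have "(s + 1 / s) / skew_ang x y * ang x y \<le> DW TYPE('a)"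
    using DW_upper[of "x /\<^sub>R norm y" "y /\<^sub>R norm x"] assms
    by (simp add: s_def skew_ang_def field_simps)
  moreover have "2 \<le> s + 1 / s"
    using s sum_squares_ge_zero[of "s - 1" 0] by (simp add: field_simps)
  then have "2 * (ang x y / skew_ang x y) \<le> (s + 1 / s) * (ang x y / skew_ang x y)"
    by (rule mult_right_mono) (simp add: ang_def skew_ang_def)
  ultimately show ?thesis by (simp add: mult.commute)
qed

text \<open>Passes to James' form of the property: at some \<open>e < 2\<close> above the
  characteristic of convexity the modulus is positive, which bounds \<open>norm (p + q)\<close> away
  from 2 once \<open>norm (p - q) \<ge> e\<close>.\<close>

lemma uniformly_nonsquareE:
  assumes "uniformly_nonsquare TYPE('a::real_normed_vector)" "\<exists>x :: 'a. x \<noteq> 0"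
  obtains \<eta> where "\<eta> > 0"
    "\<And>p q :: 'a. norm p = 1 \<Longrightarrow> norm q = 1 \<Longrightarrow> norm (p - q) \<le> 2 - \<eta> \<or> norm (p + q) \<le> 2 - \<eta>"
proof -
  \<comment> \<open>The midpoint lies strictly between \<open>char_convexity\<close> and 2; the
    maximum puts \<open>e\<close> into the interval from 0 to 2.\<close>
  define e where "e = max 0 ((char_convexity TYPE('a) + 2) / 2)"
  define S where
    "S = {1 - norm ((x + y) /\<^sub>R 2) | x y :: 'a. norm x = 1 \<and> norm y = 1 \<and> norm (x - y) \<ge> e}"
  have e: "0 \<le> e" "e < 2" "char_convexity TYPE('a) < e"
    using assms(1) by (auto simp: e_def uniformly_nonsquare_def max_def)
  have nonneg: "0 \<le> t" if t: "t \<in> S" for t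
  proof -
    obtain x y :: 'a where "t = 1 - norm ((x + y) /\<^sub>R 2)" "norm x = 1" "norm y = 1"
      using t unfolding S_def by blast
    then show ?thesis using norm_triangle_ineq[of x y] by simp
  qed
  obtain x :: 'a where "x \<noteq> 0" using assms(2) by blast
  define u where "u = x /\<^sub>R norm x"
  have u: "norm u = 1" using \<open>x \<noteq> 0\<close> by (simp add: u_def)
  have "norm (u - - u) = 2" using u by (simp flip: scaleR_2)
  with u e have "1 - norm ((u + - u) /\<^sub>R 2) \<in> S"
    unfolding S_def by (intro CollectI exI[of _ u] exI[of _ "- u"]) auto
  then have "S \<noteq> {}" by blast
  then have "Inf S \<ge> 0" using nonneg by (rule cInf_greatest)
  moreover have "Inf S \<noteq> 0"
  proof
    assume "Inf S = 0"
    then have "e \<in> {e \<in> {0..2}. modulus_convexity TYPE('a) e = 0}"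
      using e by (simp add: modulus_convexity_def S_def)
    then have "e \<le> char_convexity TYPE('a)"
      unfolding char_convexity_def by (rule cSup_upper) (auto intro: bdd_aboveI[of _ 2])
    with e show False by simp
  qed
  ultimately have "Inf S > 0" by simp
  show thesis
  \<comment> \<open>The first term serves the case \<open>norm (p - q) < e\<close>, the second the
    case where the modulus applies to \<open>p\<close> and \<open>q\<close>.\<close>
  proof (rule that[of "min (2 - e) (2 * Inf S)"])
    show "min (2 - e) (2 * Inf S) > 0" using e \<open>Inf S > 0\<close> by simp
    fix p q :: 'a
    assume pq: "norm p = 1" "norm q = 1"
    show "norm (p - q) \<le> 2 - min (2 - e) (2 * Inf S) \<or> norm (p + q) \<le> 2 - min (2 - e) (2 * Inf S)"
    proof (cases "norm (p - q) \<ge> e")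
      case True
      with pq have "1 - norm ((p + q) /\<^sub>R 2) \<in> S" unfolding S_def by blast
      then have "Inf S \<le> 1 - norm ((p + q) /\<^sub>R 2)"
        using nonneg by (intro cInf_lower bdd_belowI) auto
      then show ?thesis by (auto simp: min_def)
    qed (auto simp: min_def)
  qed
qed

lemma unit_vectors_skew_bound:
  fixes u v :: "'a::real_normed_vector"
  assumes nonsquare: "\<And>p q :: 'a. norm p = 1 \<Longrightarrow> norm q = 1 \<Longrightarrow>
      norm (p - q) \<le> 2 - \<eta> \<or> norm (p + q) \<le> 2 - \<eta>"
    and c: "0 < c" "c \<le> 1 / 8" "2 * c < \<eta>"
    and uv: "norm u = 1" "norm v = 1" and s: "1 \<le> s"
    and pos: "s *\<^sub>R u - v /\<^sub>R s \<noteq> 0"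
  shows "norm (u - v) \<le> (2 - c) * norm (s *\<^sub>R u - v /\<^sub>R s)"
proof (rule ccontr)
  assume not_le: "\<not> ?thesis"
  define w where "w = s *\<^sub>R u - v /\<^sub>R s"
  define b where "b = norm w"
  define t where "t = s - 1 / s"
  have b: "b > 0" using pos by (simp add: b_def w_def)
  have far: "norm (u - v) > (2 - c) * b"
    using not_le by (simp add: b_def w_def)
  have t0: "t \<ge> 0" using s by (simp add: t_def field_simps mult_ge1_I)
  have t_le: "t \<le> b"
    using norm_triangle_ineq2[of "s *\<^sub>R u" "v /\<^sub>R s"] s uv
    by (simp add: t_def b_def w_def divide_inverse)
  have "s *\<^sub>R (u - v) = w - t *\<^sub>R v"
    using s by (simp add: w_def t_def algebra_simps divide_inverse)
  then have s_ang: "norm (w - t *\<^sub>R v) = s * norm (u - v)"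
    using s by (metis abs_of_nonneg norm_scaleR order_trans zero_le_one)
  then have le: "s * norm (u - v) \<le> b + t"
    using norm_triangle_ineq4[of w "t *\<^sub>R v"] t0 uv by (simp add: b_def)
  have s_far: "s * ((2 - c) * b) < s * norm (u - v)"
    using far s by simp
  have far': "(2 - c) * b < s * norm (u - v)"
  proof -
    have "1 * ((2 - c) * b) \<le> s * ((2 - c) * b)"
      using s b c by (intro mult_right_mono) auto
    with s_far show ?thesis by simp
  qed
  \<comment> \<open>The lower bound \<open>far'\<close> and the triangle bound \<open>le\<close>
    squeeze \<open>t\<close> between \<open>(1 - c) * b\<close> and \<open>b\<close>.\<close>
  have t_ge: "(1 - c) * b < t"
    using far' le by (simp add: algebra_simps)
  have s_small: "s \<le> 16 / 15"
  proof -
    have "(s * (2 - c)) * b < 2 * b" using s_far le t_le by (simp add: mult.assoc)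
    then have "s * (2 - c) < 2" using b by simp
    moreover have "s * (15 / 8) \<le> s * (2 - c)" using c s by (intro mult_left_mono) auto
    ultimately show ?thesis by simp
  qed
  have inv_s: "1 / s \<ge> 15 / 16" using s s_small by (simp add: field_simps)
  \<comment> \<open>Makes the coefficient \<open>1 / s - b\<close> in the proof of
    \<open>plus\<close> nonnegative. Here \<open>t\<close> is at most 16/15 - 15/16, which is far
    below 7/8 of 15/16.\<close>
  have b_le: "b \<le> 1 / s"
  proof -
    have "7 / 8 * b \<le> (1 - c) * b" using b c by (intro mult_right_mono) auto
    then have "7 / 8 * b \<le> t" using t_ge by simp
    then show ?thesis using inv_s s_small by (simp add: t_def)
  qed
  \<comment> \<open>Replacing \<open>t\<close> by \<open>b\<close> costs
    \<open>b - t < c * b\<close>, so the loss grows from \<open>c\<close> to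
    \<open>2 * c\<close>.\<close>
  have minus: "norm (w - b *\<^sub>R v) > (2 - 2 * c) * b"
  proof -
    have "norm (w - t *\<^sub>R v) \<le> norm (w - b *\<^sub>R v) + norm ((b - t) *\<^sub>R v)"
      using norm_triangle_ineq[of "w - b *\<^sub>R v" "(b - t) *\<^sub>R v"]
      by (simp add: scaleR_left_diff_distrib)
    then have "(2 - c) * b < norm (w - b *\<^sub>R v) + (b - t)"
      using far' s_ang t_le uv by simp
    then show ?thesis using t_ge by (simp add: algebra_simps)
  qed
  have plus: "norm (w + b *\<^sub>R v) > (2 - 2 * c) * b"
  proof -
    have "w + b *\<^sub>R v = s *\<^sub>R u - (1 / s - b) *\<^sub>R v"
      by (simp add: w_def scaleR_left_diff_distrib divide_inverse)
    then have "t + b \<le> norm (w + b *\<^sub>R v)"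
      using norm_triangle_ineq2[of "s *\<^sub>R u" "(1 / s - b) *\<^sub>R v"] uv s b_le
      by (simp add: t_def)
    moreover have "c * b > 0" using c b by simp
    ultimately show ?thesis using t_ge by (simp add: algebra_simps)
  qed
  have scale: "norm (w /\<^sub>R b - v) = norm (w - b *\<^sub>R v) / b"
    "norm (w /\<^sub>R b + v) = norm (w + b *\<^sub>R v) / b"
  proof -
    have "w /\<^sub>R b - v = (w - b *\<^sub>R v) /\<^sub>R b" "w /\<^sub>R b + v = (w + b *\<^sub>R v) /\<^sub>R b"
      using b by (simp_all add: scaleR_diff_right scaleR_add_right)
    then show "norm (w /\<^sub>R b - v) = norm (w - b *\<^sub>R v) / b"
      "norm (w /\<^sub>R b + v) = norm (w + b *\<^sub>R v) / b"
      using b by (simp_all add: divide_inverse mult.commute)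
  qed
  have "2 - 2 * c < norm (w /\<^sub>R b - v)" "2 - 2 * c < norm (w /\<^sub>R b + v)"
    unfolding scale using minus plus b by (simp_all add: pos_less_divide_eq)
  moreover have "norm (w /\<^sub>R b) = 1" using b by (simp add: b_def)
  ultimately show False using nonsquare[of "w /\<^sub>R b" v] uv c by auto
qed

lemma uniformly_nonsquare_ang_bound:
  assumes "uniformly_nonsquare TYPE('a::real_normed_vector)" "\<exists>x :: 'a. x \<noteq> 0"
  obtains c where "c > 0"
    "\<And>x y :: 'a. x \<noteq> 0 \<Longrightarrow> y \<noteq> 0 \<Longrightarrow> skew_ang x y \<noteq> 0 \<Longrightarrow> ang x y \<le> (2 - c) * skew_ang x y"
proof -
  obtain \<eta> where \<eta>: "\<eta> > 0"
    and ns: "\<And>p q :: 'a. norm p = 1 \<Longrightarrow> norm q = 1 \<Longrightarrow>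
      norm (p - q) \<le> 2 - \<eta> \<or> norm (p + q) \<le> 2 - \<eta>"
    using uniformly_nonsquareE[OF assms] by metis
  \<comment> \<open>The 1/8 keeps \<open>s\<close> near 1, and \<open>\<eta> / 4\<close> leaves the
    doubled loss \<open>2 * c\<close> below \<open>\<eta>\<close>.\<close>
  define c where "c = min (1 / 8) (\<eta> / 4)"
  have c: "0 < c" "c \<le> 1 / 8" "2 * c < \<eta>" using \<eta> by (auto simp: c_def min_def)
  have ordered: "ang x y \<le> (2 - c) * skew_ang x y"
    if xy: "x \<noteq> 0" "y \<noteq> 0" "skew_ang x y \<noteq> 0" "norm y \<le> norm x" for x y :: 'a
  proof -
    define s where "s = norm x / norm y"
    define u where "u = x /\<^sub>R norm x"
    define v where "v = y /\<^sub>R norm y"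
    have uv: "norm u = 1" "norm v = 1" "1 \<le> s"
      using xy by (simp_all add: u_def v_def s_def)
    have eq: "skew_ang x y = norm (s *\<^sub>R u - v /\<^sub>R s)" "ang x y = norm (u - v)"
      using xy by (simp_all add: skew_ang_def ang_def u_def v_def s_def field_simps)
    show ?thesis
      unfolding eq using xy(3) eq by (intro unit_vectors_skew_bound[OF ns c uv]) auto
  qed
  show thesis
  proof (rule that[OF c(1)])
    fix x y :: 'a
    assume "x \<noteq> 0" "y \<noteq> 0" "skew_ang x y \<noteq> 0"
    \<comment> \<open>Both quantities are symmetric, so the vector of larger norm may come first,
      which gives \<open>s \<ge> 1\<close>.\<close>
    then show "ang x y \<le> (2 - c) * skew_ang x y"
      using ordered[of x y] ordered[of y x] ang_commute[of x y] skew_ang_commute[of x y]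
      by (cases "norm y \<le> norm x") auto
  qed
qed

theorem theorem3p1:
  assumes dim_ge_2: "\<exists>x y :: 'a::banach. x \<noteq> y \<and> independent {x, y}"
  shows "(uniformly_nonsquare TYPE('a) \<longrightarrow> DR_B TYPE('a) < 2)
       \<and> DR_B TYPE('a) \<le> DR TYPE('a)
       \<and> DR TYPE('a) \<le> 1 / 2 * DW TYPE('a)
       \<and> (DW TYPE('a) < 4 \<longrightarrow> DR_B TYPE('a) < 2)"
proof -
  obtain z y :: 'a where zy: "z \<noteq> 0" "y \<noteq> 0" "z \<bottom>\<^sub>B y" "skew_ang z y \<noteq> 0"
    using dim_ge_2 birkhoff_orth_pair_exists by metis
  have DR_le: "DR TYPE('a) \<le> B"
    if "\<And>x y :: 'a. x \<noteq> 0 \<Longrightarrow> y \<noteq> 0 \<Longrightarrow> skew_ang x y \<noteq> 0 \<Longrightarrow> ang x y / skew_ang x y \<le> B" for B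
    unfolding DR_def by (rule cSup_least) (use zy that in blast)+
  have DR_B_le: "DR_B TYPE('a) \<le> DR TYPE('a)"
    unfolding DR_B_def DR_def
    by (rule cSup_subset_mono[OF _ bdd_above_DR]) (use zy in blast)+
  have DR_DW: "DR TYPE('a) \<le> 1 / 2 * DW TYPE('a)"
    by (intro DR_le ang_le_half_DW_times_skew_ang)
  \<comment> \<open>A strict bound survives the supremum because \<open>c\<close> is uniform in
    \<open>x\<close> and \<open>y\<close>; it holds for \<open>DR\<close> and passes to
    \<open>DR_B\<close>.\<close>
  have "DR TYPE('a) < 2" if uns: "uniformly_nonsquare TYPE('a)"
  proof -
    obtain c where c: "c > 0"
      and bound: "\<And>x y :: 'a. x \<noteq> 0 \<Longrightarrow> y \<noteq> 0 \<Longrightarrow> skew_ang x y \<noteq> 0 \<Longrightarrow>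
        ang x y \<le> (2 - c) * skew_ang x y"
      using uniformly_nonsquare_ang_bound[OF uns] zy(1) by metis
    have "skew_ang x y > 0" if "skew_ang x y \<noteq> 0" for x y :: 'a
      using that by (simp add: skew_ang_def)
    then have "DR TYPE('a) \<le> 2 - c"
      using bound by (intro DR_le) (simp add: divide_le_eq)
    with c show ?thesis by simp
  qed
  with DR_B_le DR_DW show ?thesis by auto
qed

end
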